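(* Let $K$ be a solid closed cone in a finite dimensional real normed space. If $\mathcal{A}$ is a bounded, primitive family of continuous, order-preserving, homogeneous maps $f:K\to K$ with generalized spectral radius $r(\mathcal{A})=1$, then the semigroup $\mathcal{A}^+$ is bounded.
   Context: A cone in a real normed space is a convex set $K$ with $\lambda K\subseteq K$ for all $\lambda>0$ and $K\cap(-K)=\{0\}$; it is solid if it has nonempty interior. A closed cone $K$ defines the partial order $x\ge y\iff x-y\in K$. A map $f$ is order-preserving if $f(x)\ge f(y)$ whenever $x\ge y$, and homogeneous if $f(cx)=cf(x)$ for all $c>0$. $\|f\|:=\sup\{\|f(x)\| : x\in K, \|x\|=1\}$ (for $K$ non-zero); a family $\mathcal{F}$ of homogeneous maps is bounded if $\{\|f\| : f\in\mathcal{F}\}$ is bounded. For a homogeneous $f:K\to K$ with $\|f\|<\infty$, $r(f):=\lim_{k\to\infty}\|f^k\|^{1/k}=\inf_{k>0}\|f^k\|^{1/k}$. For $m\ge1$, $\mathcal{A}^m:=\{f_m\circ\cdots\circ f_1 : f_i\in\mathcal{A}\}$, and $\mathcal{A}^+:=\bigcup_{m>0}\mathcal{A}^m$. The generalized spectral radius is $r(\mathcal{A}):=\limsup_{m\to\infty}\sup_{f\in\mathcal{A}^m}r(f)^{1/m}=\sup_{m>0}\sup_{f\in\mathcal{A}^m}r(f)^{1/m}$. $\mathcal{A}$ is primitive if for every nonzero $x\in K$ there exists $f\in\mathcal{A}^+$ such that $f(x)$ lies in the interior of $K$. *)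

theory Defs
  imports "HOL-Analysis.Analysis"
begin

definition finite_dimensional :: "'a::real_vector itself \<Rightarrow> bool" where
  "finite_dimensional _ \<longleftrightarrow> (\<exists>B::'a set. finite B \<and> span B = UNIV)"

text \<open>
  The library predicate \<open>cone\<close> requires closure under scaling by all \<open>c \<ge> 0\<close> but neither
  convexity nor pointedness, hence the separate notion.
\<close>
definition pointed_cone :: "'a::real_vector set \<Rightarrow> bool" where
  "pointed_cone K \<longleftrightarrow>
     convex K \<and> (\<forall>c>0. (\<lambda>x. c *\<^sub>R x) ` K \<subseteq> K) \<and> K \<inter> uminus ` K = {0}"

definition solid :: "'a::topological_space set \<Rightarrow> bool" where
  "solid K \<longleftrightarrow> interior K \<noteq> {}"

definition cone_ge :: "'a::real_vector set \<Rightarrow> 'a \<Rightarrow> 'a \<Rightarrow> bool" where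
  "cone_ge K x y \<longleftrightarrow> x - y \<in> K"

text \<open>
  A map \<open>K \<rightarrow> K\<close> is represented by a total function \<open>f\<close> with \<open>f \<in> K \<rightarrow> K\<close>. Every notion below
  depends only on the values of \<open>f\<close> on \<open>K\<close>.
\<close>

definition order_preserving_on :: "'a::real_vector set \<Rightarrow> ('a \<Rightarrow> 'a) \<Rightarrow> bool" where
  "order_preserving_on K f \<longleftrightarrow> (\<forall>x\<in>K. \<forall>y\<in>K. cone_ge K x y \<longrightarrow> cone_ge K (f x) (f y))"

definition homogeneous_on :: "'a::real_vector set \<Rightarrow> ('a \<Rightarrow> 'a) \<Rightarrow> bool" where
  "homogeneous_on K f \<longleftrightarrow> (\<forall>c>0. \<forall>x\<in>K. f (c *\<^sub>R x) = c *\<^sub>R f x)"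

text \<open>
  The supremum is taken in \<^typ>\<open>ennreal\<close>: it is \<open>\<infinity>\<close> for a map that is unbounded on the unit
  sphere of \<open>K\<close>, and \<open>0\<close> in the degenerate case \<open>K = {0}\<close>.
\<close>
definition cone_norm :: "'a::real_normed_vector set \<Rightarrow> ('a \<Rightarrow> 'a) \<Rightarrow> ennreal" where
  "cone_norm K f = (SUP x\<in>{x\<in>K. norm x = 1}. ennreal (norm (f x)))"

definition bounded_family :: "'a::real_normed_vector set \<Rightarrow> ('a \<Rightarrow> 'a) set \<Rightarrow> bool" where
  "bounded_family K F \<longleftrightarrow> (\<exists>M::real. \<forall>f\<in>F. cone_norm K f \<le> ennreal M)"

text \<open>
  Meant for homogeneous \<open>f \<in> K \<rightarrow> K\<close> with \<open>cone_norm K f < \<infinity>\<close>. Then the norms of all iterates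
  are finite, so \<^const>\<open>enn2real\<close> loses nothing, and the limit exists by submultiplicativity.
\<close>
definition spectral_radius :: "'a::real_normed_vector set \<Rightarrow> ('a \<Rightarrow> 'a) \<Rightarrow> real" where
  "spectral_radius K f = lim (\<lambda>k. root k (enn2real (cone_norm K (f ^^ k))))"

primrec family_power :: "('a \<Rightarrow> 'a) set \<Rightarrow> nat \<Rightarrow> ('a \<Rightarrow> 'a) set" where
  "family_power A 0 = {id}"
| "family_power A (Suc m) = {f \<circ> g | f g. f \<in> A \<and> g \<in> family_power A m}"

definition generated_semigroup :: "('a \<Rightarrow> 'a) set \<Rightarrow> ('a \<Rightarrow> 'a) set" where
  "generated_semigroup A = (\<Union>m\<in>{0<..}. family_power A m)"

definition generalized_spectral_radius ::
    "'a::real_normed_vector set \<Rightarrow> ('a \<Rightarrow> 'a) set \<Rightarrow> ennreal" where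
  "generalized_spectral_radius K A =
     limsup (\<lambda>m. SUP f\<in>family_power A m. ennreal (root m (spectral_radius K f)))"

definition primitive_family :: "'a::real_normed_vector set \<Rightarrow> ('a \<Rightarrow> 'a) set \<Rightarrow> bool" where
  "primitive_family K A \<longleftrightarrow>
     (\<forall>x\<in>K. x \<noteq> 0 \<longrightarrow> (\<exists>f\<in>generated_semigroup A. f x \<in> interior K))"

end

theory Submission imports Defs begin

text \<open>
  Fix \<open>u\<close> in the interior of \<open>K\<close>. The size of an order-preserving homogeneous map \<open>g\<close> is
  governed by the single vector \<open>g u\<close>: every unit vector \<open>x\<close> of \<open>K\<close> is below a fixed multiple
  of \<open>u\<close>, so \<open>g x\<close> is below the same multiple of \<open>g u\<close>, and a closed cone in finite dimension is
  normal, i.e. order bounds are norm bounds (\<open>cone_normal\<close>, \<open>cone_map_bound_by_interior_point\<close>).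
  It therefore suffices to bound \<open>norm (g u)\<close> over the semigroup.

  Primitivity becomes uniform by compactness of the unit sphere of \<open>K\<close>
  (\<open>primitive_uniform\<close>): there is one \<open>\<delta> > 0\<close> such that each \<open>y \<in> K\<close> is sent above
  \<open>\<delta> * norm y *\<^sub>R u\<close> by some \<open>f\<close> in the semigroup. Applied to \<open>y = g u\<close> this gives an element
  \<open>h = f \<circ> g\<close> of the semigroup with \<open>h u \<ge> \<lambda> u\<close> and \<open>\<lambda> = \<delta> * norm (g u)\<close>. Iterating,
  \<open>(h ^^ k) u \<ge> \<lambda> ^ k u\<close>, so \<open>spectral_radius K (h ^^ k) \<ge> \<lambda> ^ k\<close> by normality. If \<open>h\<close> is a
  product of \<open>m\<close> maps, the lengths \<open>m * k\<close> then contribute values \<open>\<ge> root m \<lambda>\<close> to the limit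
  superior, which is \<open>1\<close>. Hence \<open>\<lambda> \<le> 1\<close>, that is \<open>norm (g u) \<le> 1 / \<delta>\<close>.

  Since the spectral radius is a limit, a lower bound on it presupposes that the limit exists;
  this is Fekete's lemma (\<open>submultiplicative_root_convergent\<close>).
\<close>

section \<open>Roots of submultiplicative sequences\<close>

text \<open>
  A step \<open>m\<close> whose root is below \<open>q\<close> controls the whole tail: \<open>b n = a n / q ^ n\<close> is still
  submultiplicative and \<open>b m < 1\<close>, so \<open>b\<close> is bounded by its values on the residues modulo \<open>m\<close>,
  and the \<open>n\<close>-th root of that bound tends to \<open>1\<close>.
\<close>
lemma submultiplicative_root_eventually_less:
  fixes a :: "nat \<Rightarrow> real"
  assumes pos: "\<And>n. a n > 0" and sub: "\<And>m n. a (m + n) \<le> a m * a n"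
    and m: "m > 0" and q: "root m (a m) < q" and q': "q < q'"
  shows "\<forall>\<^sub>F n in sequentially. root n (a n) < q'"
proof -
  define b where "b n = a n / q ^ n" for n
  have q0: "q > 0"
    using q real_root_gt_zero[OF m pos[of m]] by linarith
  have b0: "b n > 0" for n
    using pos q0 by (simp add: b_def)
  have bsub: "b (i + j) \<le> b i * b j" for i j
    using sub[of i j] q0 by (simp add: b_def power_add divide_right_mono)
  have "a m = root m (a m) ^ m"
    using m pos[of m] by simp
  also have "\<dots> < q ^ m"
    using q m pos[of m] by (intro power_strict_mono) auto
  finally have bm: "b m \<le> 1"
    using q0 by (simp add: b_def)
  define B where "B = Max (b ` {..<m})"
  have step: "b (r + m * k) \<le> b r" for r k
  proof (induction k)
    case (Suc k)
    have "b (r + m * Suc k) = b ((r + m * k) + m)"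
      by (simp add: algebra_simps)
    also have "\<dots> \<le> b (r + m * k) * b m"
      by (rule bsub)
    also have "\<dots> \<le> b (r + m * k)"
      using bm b0[of "r + m * k"] by (simp add: mult_left_le)
    finally show ?case
      using Suc by linarith
  qed simp
  have bB: "b n \<le> B" for n
  proof -
    have "b n \<le> b (n mod m)"
      using step[of "n mod m" "n div m"] by simp
    also have "\<dots> \<le> B"
      using m unfolding B_def by (intro Max_ge) auto
    finally show ?thesis .
  qed
  have B0: "B > 0"
    using bB[of 0] b0[of 0] by linarith
  have "(\<lambda>n. root n B * q) \<longlonglongrightarrow> 1 * q"
    by (intro tendsto_intros LIMSEQ_root_const B0)
  then have "\<forall>\<^sub>F n in sequentially. root n B * q < q'"
    using q' by (intro order_tendstoD(2)[where y = "1 * q"]) simp_all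
  then show ?thesis
    using eventually_gt_at_top[of 0]
  proof eventually_elim
    case (elim n)
    have "a n = b n * q ^ n"
      using q0 by (simp add: b_def)
    also have "\<dots> \<le> B * q ^ n"
      using bB q0 by (intro mult_right_mono) auto
    finally have "root n (a n) \<le> root n (B * q ^ n)"
      using elim by simp
    also have "\<dots> = root n B * q"
      using elim q0 by (simp add: real_root_mult real_root_power_cancel)
    finally show ?case
      using elim by linarith
  qed
qed

lemma submultiplicative_root_convergent:
  fixes a :: "nat \<Rightarrow> real"
  assumes pos: "\<And>n. a n > 0" and sub: "\<And>m n. a (m + n) \<le> a m * a n"
  shows "convergent (\<lambda>n. root n (a n))"
proof -
  define L where "L = (INF n\<in>{0<..}. root n (a n))"
  have bdd: "bdd_below ((\<lambda>n. root n (a n)) ` {0<..})"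
    using pos by (intro bdd_belowI[of _ 0]) (auto simp: less_imp_le)
  have "(\<lambda>n. root n (a n)) \<longlonglongrightarrow> L"
  proof (rule order_tendstoI)
    fix y assume "y < L"
    show "\<forall>\<^sub>F n in sequentially. y < root n (a n)"
      using eventually_gt_at_top[of 0]
    proof eventually_elim
      case (elim n)
      then have "L \<le> root n (a n)"
        unfolding L_def by (intro cINF_lower bdd) auto
      then show ?case
        using \<open>y < L\<close> by linarith
    qed
  next
    fix y assume "L < y"
    then obtain q where q: "L < q" "q < y"
      using dense by blast
    then obtain m where "m > 0" "root m (a m) < q"
      unfolding L_def by (subst (asm) cINF_less_iff[OF _ bdd]) auto
    then show "\<forall>\<^sub>F n in sequentially. root n (a n) < y"
      using submultiplicative_root_eventually_less[OF pos sub] q by blast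
  qed
  then show ?thesis
    by (rule convergentI)
qed

section \<open>Compactness in finite-dimensional normed spaces\<close>

text \<open>
  Adding a vector \<open>b\<close> outside the span \<open>V\<close> keeps bounded sequences subconvergent: \<open>V\<close> is closed by
  the induction hypothesis, so \<open>b\<close> has positive distance \<open>d\<close> from \<open>V\<close>, and
  \<open>d * \<bar>c\<bar> \<le> norm (c *\<^sub>R b + v)\<close> bounds the coordinate \<open>c\<close> separately from \<open>v \<in> V\<close>.
\<close>
lemma bounded_sequence_in_finite_span:
  fixes B :: "'a::real_normed_vector set" and x :: "nat \<Rightarrow> 'a"
  assumes "finite B" and "\<And>n. x n \<in> span B" and "bounded (range x)"
  shows "\<exists>l\<in>span B. \<exists>r. strict_mono r \<and> (x \<circ> r) \<longlonglongrightarrow> l"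
  using assms
proof (induction B arbitrary: x rule: finite_induct)
  case empty
  then have "x = (\<lambda>n. 0)"
    by auto
  then have "(x \<circ> id) \<longlonglongrightarrow> 0"
    by simp
  then show ?case
    using strict_mono_id by auto
next
  case (insert b B)
  show ?case
  proof (cases "b \<in> span B")
    case True
    then have "span (insert b B) = span B"
      by (rule span_redundant)
    then show ?thesis
      using insert by simp
  next
    case False
    have "closed (span B)"
      unfolding closed_sequential_limits
    proof safe
      fix y l assume y: "\<forall>n. y n \<in> span B" "y \<longlonglongrightarrow> l"
      then obtain l' r where "l' \<in> span B" "strict_mono r" "(y \<circ> r) \<longlonglongrightarrow> l'"
        using insert.IH[of y] convergent_imp_bounded by blast
      then show "l \<in> span B"
        using LIMSEQ_subseq_LIMSEQ[OF y(2)] LIMSEQ_unique by blast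
    qed
    moreover have "span B \<noteq> {}"
      using span_zero by blast
    ultimately have d: "infdist b (span B) > 0" (is "?d > 0")
      using False by (intro infdist_pos_not_in_closed)
    have coord: "?d * \<bar>c\<bar> \<le> norm (c *\<^sub>R b + v)" if "v \<in> span B" for c v
    proof (cases "c = 0")
      case c: False
      have "(- 1 / c) *\<^sub>R v \<in> span B"
        using that by (rule span_scale)
      then have "?d \<le> dist b ((- 1 / c) *\<^sub>R v)"
        by (rule infdist_le)
      also have "\<dots> = norm ((1 / c) *\<^sub>R (c *\<^sub>R b + v))"
        using c by (simp add: dist_norm scaleR_add_right)
      also have "\<dots> = norm (c *\<^sub>R b + v) / \<bar>c\<bar>"
        by simp
      finally show ?thesis
        using c by (simp add: field_simps)
    qed simp
    have "\<forall>n. \<exists>c. x n - c *\<^sub>R b \<in> span B"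
      using insert.prems(1) by (simp add: span_breakdown_eq)
    then obtain c where c: "\<And>n. x n - c n *\<^sub>R b \<in> span B"
      by metis
    obtain M where M: "\<And>n. norm (x n) \<le> M"
      using insert.prems(2) by (auto simp: bounded_iff)
    have cM: "\<bar>c n\<bar> \<le> M / ?d" for n
    proof -
      have "?d * \<bar>c n\<bar> \<le> norm (c n *\<^sub>R b + (x n - c n *\<^sub>R b))"
        using c by (rule coord)
      also have "\<dots> \<le> M"
        using M[of n] by simp
      finally show ?thesis
        using d by (simp add: field_simps)
    qed
    then have "bounded (range c)"
      by (auto simp: bounded_iff)
    then obtain c0 r where r: "strict_mono r" "(c \<circ> r) \<longlonglongrightarrow> c0"
      using bounded_imp_convergent_subsequence by blast
    define y where "y n = x (r n) - c (r n) *\<^sub>R b" for n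
    have "norm (y n) \<le> M + M / ?d * norm b" for n
    proof -
      have "norm (y n) \<le> norm (x (r n)) + \<bar>c (r n)\<bar> * norm b"
        unfolding y_def by (metis norm_triangle_ineq4 norm_scaleR)
      also have "\<dots> \<le> M + M / ?d * norm b"
        by (intro add_mono mult_right_mono M cM norm_ge_zero)
      finally show ?thesis .
    qed
    then have "bounded (range y)"
      by (auto simp: bounded_iff)
    moreover have "\<And>n. y n \<in> span B"
      using c by (simp add: y_def)
    ultimately obtain l s where s: "l \<in> span B" "strict_mono s" "(y \<circ> s) \<longlonglongrightarrow> l"
      using insert.IH[of y] by blast
    have "(\<lambda>n. (c \<circ> r \<circ> s) n *\<^sub>R b + (y \<circ> s) n) \<longlonglongrightarrow> c0 *\<^sub>R b + l"
      by (intro tendsto_intros s(3) LIMSEQ_subseq_LIMSEQ[OF r(2) s(2)])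
    then have "(x \<circ> (r \<circ> s)) \<longlonglongrightarrow> c0 *\<^sub>R b + l"
      by (simp add: y_def o_def)
    moreover have "c0 *\<^sub>R b + l \<in> span (insert b B)"
      using s(1) by (auto simp: span_breakdown_eq intro!: exI[of _ c0])
    ultimately show ?thesis
      using r(1) s(2) strict_mono_o by blast
  qed
qed

lemma finite_dimensional_closed_bounded_imp_compact:
  fixes S :: "'a::real_normed_vector set"
  assumes "finite_dimensional TYPE('a)" and "closed S" and "bounded S"
  shows "compact S"
  unfolding compact_eq_seq_compact_metric
proof (rule seq_compactI)
  fix x :: "nat \<Rightarrow> 'a" assume x: "\<forall>n. x n \<in> S"
  obtain B :: "'a set" where "finite B" "span B = UNIV"
    using assms(1) by (auto simp: finite_dimensional_def)
  moreover have "bounded (range x)"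
    using x by (intro bounded_subset[OF assms(3)]) auto
  ultimately obtain l r where r: "strict_mono r" "(x \<circ> r) \<longlonglongrightarrow> l"
    using bounded_sequence_in_finite_span[of B x] by auto
  moreover have "l \<in> S"
    using closed_sequentially[OF assms(2) _ r(2)] x by simp
  ultimately show "\<exists>l\<in>S. \<exists>r. strict_mono r \<and> (x \<circ> r) \<longlonglongrightarrow> l"
    by blast
qed

section \<open>Closed cones\<close>

lemma pointed_cone_zero: "pointed_cone K \<Longrightarrow> 0 \<in> K"
  by (auto simp: pointed_cone_def)

lemma pointed_cone_antisym: "pointed_cone K \<Longrightarrow> x \<in> K \<Longrightarrow> - x \<in> K \<Longrightarrow> x = 0"
  unfolding pointed_cone_def by (metis IntI image_eqI minus_minus singletonD)

lemma pointed_cone_scale: "pointed_cone K \<Longrightarrow> x \<in> K \<Longrightarrow> c \<ge> 0 \<Longrightarrow> c *\<^sub>R x \<in> K"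
  using pointed_cone_zero[of K]
  by (cases "c = 0") (auto simp: pointed_cone_def image_subset_iff)

lemma pointed_cone_add:
  assumes "pointed_cone K" "x \<in> K" "y \<in> K"
  shows "x + y \<in> K"
proof -
  have "(1/2) *\<^sub>R x + (1/2) *\<^sub>R y \<in> K"
    using assms by (intro convexD) (auto simp: pointed_cone_def)
  then have "2 *\<^sub>R ((1/2) *\<^sub>R x + (1/2) *\<^sub>R y) \<in> K"
    using assms(1) by (intro pointed_cone_scale) auto
  then show ?thesis
    by (simp add: scaleR_add_right)
qed

lemma compact_cone_sphere:
  fixes K :: "'a::real_normed_vector set"
  assumes "finite_dimensional TYPE('a)" and "closed K"
  shows "compact (K \<inter> sphere 0 1)"
proof (rule finite_dimensional_closed_bounded_imp_compact[OF assms(1)])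
  have "closed {x::'a. norm x = 1}"
    by (intro closed_Collect_eq continuous_intros)
  moreover have "sphere 0 1 = {x::'a. norm x = 1}"
    by auto
  ultimately show "closed (K \<inter> sphere 0 1)"
    using assms(2) by (simp add: closed_Int)
  show "bounded (K \<inter> sphere 0 1)"
    by (auto simp: bounded_iff)
qed

text \<open>
  The constant is the distance between the unit sphere of \<open>K\<close> and \<open>- K\<close>, which is positive because
  the former is compact and the latter closed: if \<open>0 \<le> x \<le> y\<close> then \<open>x - y \<in> - K\<close> lies at distance
  \<open>norm y\<close> from \<open>x\<close>.
\<close>
lemma cone_normal:
  fixes K :: "'a::real_normed_vector set"
  assumes "finite_dimensional TYPE('a)" and K: "pointed_cone K" and "closed K"
  shows "\<exists>d>0. \<forall>x\<in>K. \<forall>y. y - x \<in> K \<longrightarrow> d * norm x \<le> norm y"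
proof (cases "K \<inter> sphere 0 1 = {}")
  case True
  have "x = 0" if "x \<in> K" for x
  proof (rule ccontr)
    assume "x \<noteq> 0"
    then have "(1 / norm x) *\<^sub>R x \<in> K \<inter> sphere 0 1"
      using that K by (auto intro: pointed_cone_scale)
    then show False
      using True by blast
  qed
  then show ?thesis
    by (intro exI[of _ 1]) force
next
  case False
  define N where "N = uminus ` K"
  have "closed N" "N \<noteq> {}"
    using \<open>closed K\<close> K pointed_cone_zero[of K] by (auto simp: N_def intro: closed_negations)
  have "continuous_on (K \<inter> sphere 0 1) (\<lambda>x. infdist x N)"
    by (intro continuous_intros)
  then obtain z where z: "z \<in> K" "norm z = 1"
    and least: "\<And>x. x \<in> K \<Longrightarrow> norm x = 1 \<Longrightarrow> infdist z N \<le> infdist x N"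
    using continuous_attains_inf[OF compact_cone_sphere[OF assms(1,3)] False, of "\<lambda>x. infdist x N"]
    by auto
  have "z \<notin> N"
    using z pointed_cone_antisym[OF K, of z] by (auto simp: N_def)
  then have d: "infdist z N > 0"
    using \<open>closed N\<close> \<open>N \<noteq> {}\<close> by (intro infdist_pos_not_in_closed)
  have "infdist z N * norm x \<le> norm y" if x: "x \<in> K" and y: "y - x \<in> K" for x y
  proof (cases "x = 0")
    case False
    define c where "c = 1 / norm x"
    have c: "c > 0"
      using False by (simp add: c_def)
    have "infdist z N \<le> infdist (c *\<^sub>R x) N"
      using False x K c by (intro least pointed_cone_scale) (auto simp: c_def)
    also have "- (c *\<^sub>R (y - x)) \<in> N"
      unfolding N_def using K c y by (intro imageI pointed_cone_scale) auto
    then have "infdist (c *\<^sub>R x) N \<le> dist (c *\<^sub>R x) (- (c *\<^sub>R (y - x)))"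
      by (rule infdist_le)
    also have "\<dots> = c * norm y"
      using c by (simp add: dist_norm scaleR_diff_right)
    finally show ?thesis
      using False by (simp add: c_def field_simps)
  qed simp
  with d show ?thesis
    by blast
qed

lemma interior_point_dominates:
  fixes K :: "'a::real_normed_vector set"
  assumes K: "pointed_cone K" and "u \<in> interior K"
  shows "\<exists>C>0. \<forall>x. (C * norm x) *\<^sub>R u - x \<in> K"
proof -
  obtain e where e: "e > 0" "cball u e \<subseteq> K"
    using assms(2) by (auto simp: mem_interior_cball)
  have "(1 / e * norm x) *\<^sub>R u - x \<in> K" for x
  proof (cases "x = 0")
    case True
    then show ?thesis
      using pointed_cone_zero[OF K] by simp
  next
    case False
    have "u - (e / norm x) *\<^sub>R x \<in> K"
      using e False by (auto intro!: subsetD[OF e(2)] simp: dist_norm)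
    then have "(1 / e * norm x) *\<^sub>R (u - (e / norm x) *\<^sub>R x) \<in> K"
      using e by (intro pointed_cone_scale[OF K]) auto
    then show ?thesis
      using e False by (simp add: scaleR_diff_right)
  qed
  then show ?thesis
    using e(1) by (intro exI[of _ "1 / e"]) simp
qed

section \<open>Order-preserving homogeneous maps\<close>

definition cone_map :: "'a::real_normed_vector set \<Rightarrow> ('a \<Rightarrow> 'a) \<Rightarrow> bool" where
  "cone_map K f \<longleftrightarrow>
     f \<in> K \<rightarrow> K \<and> continuous_on K f \<and> order_preserving_on K f \<and> homogeneous_on K f"

lemma cone_map_in: "cone_map K f \<Longrightarrow> x \<in> K \<Longrightarrow> f x \<in> K"
  by (auto simp: cone_map_def)

lemma cone_map_mono: "cone_map K f \<Longrightarrow> x \<in> K \<Longrightarrow> y \<in> K \<Longrightarrow> y - x \<in> K \<Longrightarrow> f y - f x \<in> K"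
  by (auto simp: cone_map_def order_preserving_on_def cone_ge_def)

lemma cone_map_zero:
  assumes "pointed_cone K" "cone_map K f"
  shows "f 0 = 0"
proof -
  have "f (2 *\<^sub>R 0) = 2 *\<^sub>R f 0"
    using assms pointed_cone_zero[of K]
    unfolding cone_map_def homogeneous_on_def by (metis zero_less_numeral)
  then show ?thesis
    by (simp add: scaleR_2)
qed

lemma cone_map_scale:
  assumes "pointed_cone K" "cone_map K f" "x \<in> K" "c \<ge> 0"
  shows "f (c *\<^sub>R x) = c *\<^sub>R f x"
  using assms cone_map_zero[OF assms(1,2)]
  by (cases "c = 0") (auto simp: cone_map_def homogeneous_on_def)

lemma cone_map_id: "cone_map K id"
  by (auto simp: cone_map_def order_preserving_on_def homogeneous_on_def)

lemma cone_map_comp: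
  assumes f: "cone_map K f" and g: "cone_map K g"
  shows "cone_map K (f \<circ> g)"
proof -
  have gK: "g \<in> K \<rightarrow> K"
    using g by (simp add: cone_map_def)
  have "continuous_on K (f \<circ> g)"
    using f g gK by (intro continuous_on_compose) (auto simp: cone_map_def intro: continuous_on_subset)
  then show ?thesis
    using f g gK
    by (auto simp: cone_map_def order_preserving_on_def homogeneous_on_def Pi_iff)
qed

lemma cone_map_funpow: "cone_map K f \<Longrightarrow> cone_map K (f ^^ n)"
  by (induction n) (simp_all add: cone_map_id cone_map_comp)

lemma family_power_cone_map:
  assumes "\<And>f. f \<in> A \<Longrightarrow> cone_map K f" and "f \<in> family_power A m"
  shows "cone_map K f"
  using assms(2) by (induction m arbitrary: f) (auto simp: cone_map_id intro: cone_map_comp assms(1))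

lemma family_power_comp:
  assumes "f \<in> family_power A m" "g \<in> family_power A n"
  shows "f \<circ> g \<in> family_power A (m + n)"
  using assms(1)
proof (induction m arbitrary: f)
  case (Suc m)
  then obtain p f' where f: "f = p \<circ> f'" "p \<in> A" "f' \<in> family_power A m"
    by auto
  then have "f \<circ> g = p \<circ> (f' \<circ> g)" "f' \<circ> g \<in> family_power A (m + n)"
    using Suc.IH by (simp_all only: o_assoc)
  with f(2) show ?case
    unfolding add_Suc family_power.simps by blast
qed (use assms(2) in simp)

lemma family_power_funpow:
  assumes "f \<in> family_power A m"
  shows "f ^^ k \<in> family_power A (m * k)"
proof (induction k)
  case (Suc k)
  show ?case
    using family_power_comp[OF assms Suc] by (simp only: funpow.simps mult_Suc_right)
qed (simp add: id_def)

lemma cone_map_bound_by_interior_point: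
  fixes K :: "'a::real_normed_vector set"
  assumes "finite_dimensional TYPE('a)" and K: "pointed_cone K" and "closed K"
    and u: "u \<in> interior K"
  shows "\<exists>M>0. \<forall>f. cone_map K f \<longrightarrow> (\<forall>x\<in>K. norm (f x) \<le> M * norm (f u) * norm x)"
proof -
  obtain d where d: "d > 0" "\<And>x y. x \<in> K \<Longrightarrow> y - x \<in> K \<Longrightarrow> d * norm x \<le> norm y"
    using cone_normal[OF assms(1-3)] by blast
  obtain C where C: "C > 0" "\<And>x. (C * norm x) *\<^sub>R u - x \<in> K"
    using interior_point_dominates[OF K u] by blast
  have uK: "u \<in> K"
    using u interior_subset by blast
  have "norm (f x) \<le> C / d * norm (f u) * norm x" if f: "cone_map K f" and x: "x \<in> K" for f x
  proof -
    have "f ((C * norm x) *\<^sub>R u) - f x \<in> K"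
      using C x uK by (intro cone_map_mono[OF f] pointed_cone_scale[OF K]) auto
    then have "(C * norm x) *\<^sub>R f u - f x \<in> K"
      using C uK by (simp add: cone_map_scale[OF K f])
    then have "d * norm (f x) \<le> norm ((C * norm x) *\<^sub>R f u)"
      using x by (intro d cone_map_in[OF f])
    then show ?thesis
      using d(1) C(1) by (simp add: field_simps)
  qed
  then show ?thesis
    using C(1) d(1) by (intro exI[of _ "C / d"]) auto
qed

section \<open>Cone norms and the spectral radius\<close>

lemma cone_norm_le:
  assumes "\<And>x. x \<in> K \<Longrightarrow> norm x = 1 \<Longrightarrow> norm (f x) \<le> M"
  shows "cone_norm K f \<le> ennreal M"
  unfolding cone_norm_def using assms by (intro SUP_least ennreal_leI) auto

lemma cone_norm_cone_map_finite:
  fixes K :: "'a::real_normed_vector set"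
  assumes "finite_dimensional TYPE('a)" and "pointed_cone K" and "closed K" and "solid K"
    and f: "cone_map K f"
  shows "cone_norm K f < \<infinity>"
proof -
  obtain u where "u \<in> interior K"
    using assms(4) by (auto simp: solid_def)
  then obtain M where "\<And>x. x \<in> K \<Longrightarrow> norm (f x) \<le> M * norm (f u) * norm x"
    using cone_map_bound_by_interior_point[OF assms(1-3)] f by blast
  then have "cone_norm K f \<le> ennreal (M * norm (f u))"
    by (intro cone_norm_le) fastforce
  then show ?thesis
    using le_less_trans ennreal_less_top by fastforce
qed

lemma norm_le_cone_norm:
  assumes K: "pointed_cone K" and f: "cone_map K f" and fin: "cone_norm K f < \<infinity>" and x: "x \<in> K"
  shows "norm (f x) \<le> enn2real (cone_norm K f) * norm x"
proof (cases "x = 0")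
  case True
  then show ?thesis
    using cone_map_zero[OF K f] by simp
next
  case False
  define y where "y = (1 / norm x) *\<^sub>R x"
  have y: "y \<in> K" "norm y = 1"
    using False x K by (auto simp: y_def intro: pointed_cone_scale)
  then have "ennreal (norm (f y)) \<le> cone_norm K f"
    unfolding cone_norm_def by (intro SUP_upper) auto
  then have "norm (f y) \<le> enn2real (cone_norm K f)"
    using fin enn2real_mono[of "ennreal (norm (f y))"] by simp
  moreover have "f y = (1 / norm x) *\<^sub>R f x"
    unfolding y_def by (intro cone_map_scale[OF K f x]) simp
  ultimately show ?thesis
    using False by (simp add: field_simps)
qed

lemma cone_norm_comp_le:
  assumes K: "pointed_cone K" and f: "cone_map K f" and g: "cone_map K g"
    and fin: "cone_norm K f < \<infinity>" "cone_norm K g < \<infinity>"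
  shows "enn2real (cone_norm K (f \<circ> g)) \<le> enn2real (cone_norm K f) * enn2real (cone_norm K g)"
proof (rule enn2real_leI)
  show "cone_norm K (f \<circ> g)
      \<le> ennreal (enn2real (cone_norm K f) * enn2real (cone_norm K g))"
  proof (rule cone_norm_le)
    fix x assume x: "x \<in> K" "norm x = 1"
    have "norm (f (g x)) \<le> enn2real (cone_norm K f) * norm (g x)"
      using cone_map_in[OF g] x by (intro norm_le_cone_norm[OF K f fin(1)])
    also have "\<dots> \<le> enn2real (cone_norm K f) * (enn2real (cone_norm K g) * norm x)"
      using x by (intro mult_left_mono norm_le_cone_norm[OF K g fin(2)]) auto
    finally show "norm ((f \<circ> g) x) \<le> enn2real (cone_norm K f) * enn2real (cone_norm K g)"
      using x by simp
  qed
qed simp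

lemma cone_map_funpow_superinvariant:
  assumes K: "pointed_cone K" and f: "cone_map K f" and u: "u \<in> K"
    and l: "l \<ge> 0" and super: "f u - l *\<^sub>R u \<in> K"
  shows "(f ^^ n) u - (l ^ n) *\<^sub>R u \<in> K"
proof (induction n)
  case 0
  then show ?case
    using pointed_cone_zero[OF K] by simp
next
  case (Suc n)
  have "f ((f ^^ n) u) - f ((l ^ n) *\<^sub>R u) \<in> K"
    using Suc l by (intro cone_map_mono[OF f] pointed_cone_scale[OF K u]
        cone_map_in[OF cone_map_funpow[OF f] u]) auto
  moreover have "(l ^ n) *\<^sub>R (f u - l *\<^sub>R u) \<in> K"
    using l by (intro pointed_cone_scale[OF K super]) simp
  ultimately have "f ((f ^^ n) u) - f ((l ^ n) *\<^sub>R u) + (l ^ n) *\<^sub>R (f u - l *\<^sub>R u) \<in> K"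
    by (rule pointed_cone_add[OF K])
  then show ?case
    using l by (simp add: cone_map_scale[OF K f u] scaleR_diff_right mult.commute)
qed

text \<open>
  Superinvariance iterates to \<open>(f ^^ n) u \<ge> l ^ n u\<close>, so normality makes the norms of the
  iterates at least \<open>d * l ^ n\<close>. The positive lower bound also excludes vanishing iterates, so
  Fekete's lemma applies.
\<close>
lemma spectral_radius_ge_superinvariant:
  fixes K :: "'a::real_normed_vector set"
  assumes cone: "finite_dimensional TYPE('a)" "pointed_cone K" "closed K" "solid K"
    and f: "cone_map K f" and u: "u \<in> K" "u \<noteq> 0" and l: "l > 0" and super: "f u - l *\<^sub>R u \<in> K"
  shows "l \<le> spectral_radius K f"
proof -
  note K = cone(2)
  define a where "a n = enn2real (cone_norm K (f ^^ n))" for n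
  have pw: "cone_map K (f ^^ n)" for n
    by (rule cone_map_funpow[OF f])
  have fin: "cone_norm K (f ^^ n) < \<infinity>" for n
    by (rule cone_norm_cone_map_finite[OF cone pw])
  obtain d where d: "d > 0" "\<And>x y. x \<in> K \<Longrightarrow> y - x \<in> K \<Longrightarrow> d * norm x \<le> norm y"
    using cone_normal[OF cone(1-3)] by blast
  have lower: "d * l ^ n \<le> a n" for n
  proof -
    have "d * norm ((l ^ n) *\<^sub>R u) \<le> norm ((f ^^ n) u)"
      using l u super
      by (intro d(2) pointed_cone_scale[OF K] cone_map_funpow_superinvariant[OF K f]) auto
    also have "\<dots> \<le> a n * norm u"
      unfolding a_def by (rule norm_le_cone_norm[OF K pw fin u(1)])
    finally show ?thesis
      using u(2) l by (simp add: mult.assoc[symmetric])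
  qed
  have pos: "a n > 0" for n
    using lower[of n] d(1) l by (meson less_le_trans mult_pos_pos zero_less_power)
  have sub: "a (m + n) \<le> a m * a n" for m n
    unfolding a_def funpow_add by (intro cone_norm_comp_le K pw fin)
  have "(\<lambda>n. root n (a n)) \<longlonglongrightarrow> spectral_radius K f"
    using submultiplicative_root_convergent[of a, OF pos sub]
    unfolding spectral_radius_def a_def convergent_LIMSEQ_iff .
  moreover have "(\<lambda>n. root n d * l) \<longlonglongrightarrow> 1 * l"
    by (intro tendsto_intros LIMSEQ_root_const d(1))
  moreover have "\<forall>\<^sub>F n in sequentially. root n d * l \<le> root n (a n)"
    using eventually_gt_at_top[of 0]
  proof eventually_elim
    case (elim n)
    then have "root n d * l = root n (d * l ^ n)"
      using l by (simp add: real_root_mult real_root_power_cancel)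
    also have "\<dots> \<le> root n (a n)"
      using elim lower by simp
    finally show ?case .
  qed
  ultimately have "1 * l \<le> spectral_radius K f"
    by (intro tendsto_le[OF sequentially_bot])
  then show ?thesis
    by simp
qed

text \<open>
  Every power \<open>h ^^ k\<close> inherits a superinvariance factor \<open>l ^ k\<close>, so the supremum over
  \<open>family_power A (m * k)\<close> is at least \<open>root m l\<close> for all \<open>k > 0\<close>. Thus the bound holds at
  infinitely many lengths, as a limit superior requires.
\<close>
lemma generalized_spectral_radius_ge_superinvariant:
  fixes K :: "'a::real_normed_vector set"
  assumes cone: "finite_dimensional TYPE('a)" "pointed_cone K" "closed K" "solid K"
    and A: "\<And>f. f \<in> A \<Longrightarrow> cone_map K f"
    and h: "h \<in> family_power A m" and m: "m > 0"
    and u: "u \<in> K" "u \<noteq> 0" and l: "l > 0" and super: "h u - l *\<^sub>R u \<in> K"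
  shows "ennreal (root m l) \<le> generalized_spectral_radius K A"
proof -
  define X where "X n = (SUP f\<in>family_power A n. ennreal (root n (spectral_radius K f)))" for n
  define s where "s k = m * Suc k" for k
  have hK: "cone_map K h"
    using A h by (rule family_power_cone_map)
  have "ennreal (root m l) \<le> X (s k)" for k
  proof -
    have "l ^ Suc k \<le> spectral_radius K (h ^^ Suc k)"
      using l by (intro spectral_radius_ge_superinvariant[OF cone _ u] cone_map_funpow hK
          cone_map_funpow_superinvariant[OF cone(2) hK u(1)] super) auto
    then have "root (s k) (l ^ Suc k) \<le> root (s k) (spectral_radius K (h ^^ Suc k))"
      using m by (simp add: s_def)
    moreover have "root (s k) (l ^ Suc k) = root m l"
      using l unfolding s_def real_root_mult_exp
      by (subst real_root_power_cancel) auto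
    ultimately have "ennreal (root m l) \<le> ennreal (root (s k) (spectral_radius K (h ^^ Suc k)))"
      by (simp add: ennreal_leI)
    also have "\<dots> \<le> X (s k)"
      unfolding X_def s_def by (intro SUP_upper family_power_funpow h)
    finally show ?thesis .
  qed
  then have "ennreal (root m l) \<le> limsup (X \<circ> s)"
    by (intro le_Limsup) auto
  also have "\<dots> \<le> limsup X"
    using m by (intro limsup_subseq_mono) (auto simp: s_def strict_mono_def)
  finally show ?thesis
    unfolding generalized_spectral_radius_def X_def .
qed

section \<open>Uniform primitivity and boundedness of the semigroup\<close>

text \<open>
  A failure of uniformity yields unit vectors \<open>x n \<in> K\<close> for which no \<open>f\<close> in the semigroup satisfies
  \<open>f (x n) \<ge> u / (n + 1)\<close>. At a limit point \<open>x\<close> some \<open>f\<close> maps \<open>x\<close> into the interior of \<open>K\<close>, and by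
  continuity \<open>f (x n) - u / (n + 1)\<close> enters the interior along the subsequence.
\<close>
lemma primitive_uniform:
  fixes K :: "'a::real_normed_vector set"
  assumes "finite_dimensional TYPE('a)" and K: "pointed_cone K" and "closed K"
    and A: "\<And>f. f \<in> A \<Longrightarrow> cone_map K f" and prim: "primitive_family K A"
  shows "\<exists>\<delta>>0. \<forall>x\<in>K. x \<noteq> 0 \<longrightarrow> (\<exists>f\<in>generated_semigroup A. f x - (\<delta> * norm x) *\<^sub>R u \<in> K)"
proof -
  have cm: "cone_map K f" if "f \<in> generated_semigroup A" for f
    using that by (auto simp: generated_semigroup_def intro: family_power_cone_map[OF A])
  have "\<exists>n. \<forall>x\<in>K \<inter> sphere 0 1. \<exists>f\<in>generated_semigroup A. f x - (1 / real (Suc n)) *\<^sub>R u \<in> K"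
  proof (rule ccontr)
    assume "\<not> ?thesis"
    then have "\<exists>x. \<forall>n. x n \<in> K \<inter> sphere 0 1 \<and>
        (\<forall>f\<in>generated_semigroup A. f (x n) - (1 / real (Suc n)) *\<^sub>R u \<notin> K)"
      by (intro choice) blast
    then obtain x where xS: "\<And>n. x n \<in> K \<inter> sphere 0 1"
      and bad: "\<And>n f. f \<in> generated_semigroup A \<Longrightarrow> f (x n) - (1 / real (Suc n)) *\<^sub>R u \<notin> K"
      by blast
    have "seq_compact (K \<inter> sphere 0 1)"
      using compact_cone_sphere[OF assms(1,3)] by (simp add: compact_eq_seq_compact_metric)
    then obtain y r where y: "y \<in> K \<inter> sphere 0 1" and r: "strict_mono r" "(x \<circ> r) \<longlonglongrightarrow> y"
      using xS seq_compactE[of _ x] by metis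
    have "y \<in> K" "y \<noteq> 0"
      using y by auto
    then obtain f where f: "f \<in> generated_semigroup A" "f y \<in> interior K"
      using prim by (auto simp: primitive_family_def)
    have "continuous_on K f"
      using cm[OF f(1)] by (simp add: cone_map_def)
    then have "(\<lambda>n. f ((x \<circ> r) n)) \<longlonglongrightarrow> f y"
      using xS by (intro continuous_on_tendsto_compose[OF _ r(2) \<open>y \<in> K\<close>]) auto
    moreover have "(\<lambda>n. 1 / real (Suc (r n))) \<longlonglongrightarrow> 0"
      using LIMSEQ_subseq_LIMSEQ[OF LIMSEQ_Suc[OF lim_1_over_n] r(1)] by (simp add: o_def)
    ultimately have "(\<lambda>n. f ((x \<circ> r) n) - (1 / real (Suc (r n))) *\<^sub>R u) \<longlonglongrightarrow> f y - 0 *\<^sub>R u"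
      by (intro tendsto_intros)
    then have "\<forall>\<^sub>F n in sequentially. f ((x \<circ> r) n) - (1 / real (Suc (r n))) *\<^sub>R u \<in> interior K"
      using f(2) by (intro topological_tendstoD) auto
    then obtain n where "f (x (r n)) - (1 / real (Suc (r n))) *\<^sub>R u \<in> interior K"
      by (auto simp: eventually_sequentially)
    then show False
      using bad[OF f(1)] interior_subset by blast
  qed
  then obtain n where n: "\<And>x. x \<in> K \<Longrightarrow> norm x = 1 \<Longrightarrow>
      \<exists>f\<in>generated_semigroup A. f x - (1 / real (Suc n)) *\<^sub>R u \<in> K"
    by (metis IntI mem_sphere_0)
  have "\<exists>f\<in>generated_semigroup A. f x - (1 / real (Suc n) * norm x) *\<^sub>R u \<in> K"
    if x: "x \<in> K" "x \<noteq> 0" for x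
  proof -
    define y where "y = (1 / norm x) *\<^sub>R x"
    have y: "y \<in> K" "norm y = 1" and xy: "x = norm x *\<^sub>R y"
      using x by (auto simp: y_def intro: pointed_cone_scale[OF K])
    obtain f where f: "f \<in> generated_semigroup A" "f y - (1 / real (Suc n)) *\<^sub>R u \<in> K"
      using n[OF y] by blast
    have "norm x *\<^sub>R (f y - (1 / real (Suc n)) *\<^sub>R u) \<in> K"
      by (rule pointed_cone_scale[OF K f(2) norm_ge_zero])
    moreover have "f x = norm x *\<^sub>R f y"
      using cone_map_scale[OF K cm[OF f(1)] y(1) norm_ge_zero] xy by metis
    ultimately show ?thesis
      using f(1) by (auto simp: scaleR_diff_right mult.commute intro!: bexI[of _ f])
  qed
  then show ?thesis
    by (intro exI[of _ "1 / real (Suc n)"]) auto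
qed

theorem theorem4p5:
  fixes K :: "'a::real_normed_vector set" and A :: "('a \<Rightarrow> 'a) set"
  assumes "finite_dimensional TYPE('a)"
    and "pointed_cone K" and "closed K" and "solid K"
    and "\<And>f. f \<in> A \<Longrightarrow>
           f \<in> K \<rightarrow> K \<and> continuous_on K f \<and> order_preserving_on K f \<and> homogeneous_on K f"
    and "bounded_family K A"
    and "primitive_family K A"
    and "generalized_spectral_radius K A = 1"
  shows "bounded_family K (generated_semigroup A)"
proof -
  note cone = assms(1-4)
  have A: "\<And>f. f \<in> A \<Longrightarrow> cone_map K f"
    using assms(5) by (simp add: cone_map_def)
  obtain u where ui: "u \<in> interior K"
    using assms(4) by (auto simp: solid_def)
  then have u: "u \<in> K"
    using interior_subset by blast
  obtain M where M: "M > 0"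
    "\<And>f x. cone_map K f \<Longrightarrow> x \<in> K \<Longrightarrow> norm (f x) \<le> M * norm (f u) * norm x"
    using cone_map_bound_by_interior_point[OF cone(1-3) ui] by blast
  obtain \<delta> where \<delta>: "\<delta> > 0" "\<And>x. x \<in> K \<Longrightarrow> x \<noteq> 0 \<Longrightarrow>
      \<exists>f\<in>generated_semigroup A. f x - (\<delta> * norm x) *\<^sub>R u \<in> K"
    using primitive_uniform[OF cone(1-3) A assms(7), of u] by blast
  have bound: "norm (g u) \<le> 1 / \<delta>" if g: "g \<in> generated_semigroup A" for g
  proof (rule ccontr)
    assume "\<not> ?thesis"
    then have large: "\<delta> * norm (g u) > 1"
      using \<delta>(1) by (simp add: field_simps)
    obtain i where i: "i > 0" "g \<in> family_power A i"
      using g by (auto simp: generated_semigroup_def)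
    have gK: "cone_map K g"
      by (rule family_power_cone_map[OF A i(2)])
    have "g u \<noteq> 0"
      using large by auto
    (* A zero interior point would force K to be the whole, trivial space; g u \<noteq> 0 excludes it. *)
    then have "u \<noteq> 0"
      using cone_map_zero[OF cone(2) gK] by auto
    obtain f where f: "f \<in> generated_semigroup A" "f (g u) - (\<delta> * norm (g u)) *\<^sub>R u \<in> K"
      using \<delta>(2)[OF cone_map_in[OF gK u] \<open>g u \<noteq> 0\<close>] by blast
    obtain j where j: "f \<in> family_power A j"
      using f(1) by (auto simp: generated_semigroup_def)
    have "ennreal (root (j + i) (\<delta> * norm (g u))) \<le> generalized_spectral_radius K A"
      using large i f(2) u \<open>u \<noteq> 0\<close>
      by (intro generalized_spectral_radius_ge_superinvariant[OF cone A family_power_comp[OF j i(2)],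
            where u = u]) auto
    then have "root (j + i) (\<delta> * norm (g u)) \<le> 1"
      using assms(8) by simp
    then show False
      using large i(1) by simp
  qed
  have "cone_norm K g \<le> ennreal (M * (1 / \<delta>))" if g: "g \<in> generated_semigroup A" for g
  proof (rule cone_norm_le)
    fix x assume x: "x \<in> K" "norm x = 1"
    have "cone_map K g"
      using g by (auto simp: generated_semigroup_def intro: family_power_cone_map[OF A])
    then have "norm (g x) \<le> M * norm (g u)"
      using M(2)[of g x] x by simp
    also have "\<dots> \<le> M * (1 / \<delta>)"
      using M(1) bound[OF g] by (intro mult_left_mono) auto
    finally show "norm (g x) \<le> M * (1 / \<delta>)" .
  qed
  then show ?thesis
    unfolding bounded_family_def by blast
qed

end
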